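(* Let $C(s) = \sum_{n \geq 0} \mathcal{B}_{n,n} s^n$ ($s \in \mathbb{C}$) denote the univariate ordinary generating function of the sequence of central Binomiacci numbers $\langle \mathcal{B}_{n,n} \rangle_{n\ge 0}$. Then $$C(s) = \frac{(s-1)(\sqrt{1-4s}-s)}{(s^2+4s-1)\sqrt{1-4s}}.$$
   Context: $\langle \mathcal{F}_j \rangle_{j\ge 0} = \langle 1,1,2,3,5,8,13,\ldots\rangle$ is the Fibonacci sequence indexed so that $\mathcal{F}_0=\mathcal{F}_1=1$ and $\mathcal{F}_{j+2}=\mathcal{F}_{j+1}+\mathcal{F}_j$. The Binomiacci numbers $\langle \mathcal{B}_{k,n}\rangle_{k,n\ge 0}$ are defined by $\mathcal{B}_{0,n}=\mathcal{F}_n$ for $n\ge 0$, $\mathcal{B}_{k,0}=\mathcal{F}_k$ for $k\ge 0$, and $\mathcal{B}_{k,n}=\mathcal{B}_{k,n-1}+\mathcal{B}_{k-1,n}$ for $k,n\ge 1$. The identity is one of power series at the origin, where $\sqrt{1-4s}$ denotes the branch (power series) with value $1$ at $s=0$. *)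

theory Defs
  imports "HOL-Analysis.FPS_Convergence" "HOL-Number_Theory.Fib"
begin

text \<open>
  The library sequence starts with \<open>fib 0 = 0\<close>, \<open>fib 1 = 1\<close>, so the Fibonacci sequence
  \<open>1, 1, 2, 3, 5, \<dots>\<close> indexed from 0 is \<open>\<lambda>n. fib (Suc n)\<close>.
\<close>

fun binomiacci :: "nat \<Rightarrow> nat \<Rightarrow> nat" where
  "binomiacci 0 n = fib (Suc n)"
| "binomiacci k 0 = fib (Suc k)"
| "binomiacci (Suc k) (Suc n) = binomiacci (Suc k) n + binomiacci k (Suc n)"

text \<open>The boundary clauses overlap only at \<open>(0, 0)\<close>, where they agree:\<close>

lemma binomiacci_right_0: "binomiacci k 0 = fib (Suc k)"
  by (cases k) simp_all

definition central_binomiacci_gf :: "complex fps" where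
  "central_binomiacci_gf = Abs_fps (\<lambda>n. of_nat (binomiacci n n))"

text \<open>
  The power series \<open>\<surd>(1 - 4s)\<close> with constant term 1. The first argument of
  \<^const>\<open>fps_radical\<close> only selects the root of the constant coefficient; the two lemmas
  after the definition determine the series uniquely.
\<close>

definition sqrt_1_minus_4X :: "complex fps" where
  "sqrt_1_minus_4X = fps_radical (\<lambda>k z. z powr (1 / of_nat k)) 2 (1 - 4 * fps_X)"

lemma sqrt_1_minus_4X_nth_0: "fps_nth sqrt_1_minus_4X 0 = 1"
  by (simp add: sqrt_1_minus_4X_def fps_numeral_nth)

lemma sqrt_1_minus_4X_power2: "sqrt_1_minus_4X ^ 2 = 1 - 4 * fps_X"
  unfolding sqrt_1_minus_4X_def numeral_2_eq_2
  by (subst power_radical[symmetric]) (simp_all add: fps_numeral_nth)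

end

theory Submission
  imports Defs "HOL-Complex_Analysis.Laurent_Convergence"
begin

text \<open>
  Let \<open>D\<^sub>d(s) = \<Sum>n. B\<^sub>n\<^sub>,\<^sub>n\<^sub>+\<^sub>d s\<^sup>n\<close> be the generating function of the \<open>d\<close>-th
  diagonal. The Pascal rule and the symmetry of the array give a linear recurrence in \<open>d\<close>,
  \<open>s D\<^sub>d\<^sub>+\<^sub>2 = D\<^sub>d\<^sub>+\<^sub>1 - D\<^sub>d - fib d\<close>, with the boundary condition
  \<open>D\<^sub>0 = 1 + 2 s D\<^sub>1\<close>; comparing coefficients shows that these determine all \<open>D\<^sub>d\<close>.
  With \<open>r = \<surd>(1 - 4s)\<close> and the Catalan series \<open>c = 2 / (1 + r)\<close>, which satisfies
  \<open>s c\<^sup>2 = c - 1\<close>, the homogeneous recurrence is solved by \<open>c\<^sup>d\<close>, and a particular solution is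
  a combination of Fibonacci numbers over \<open>1 - 4s - s\<^sup>2\<close>, the norm of
  \<open>s \<phi> - \<phi>\<^sup>-\<^sup>2\<close> for the golden ratio \<open>\<phi>\<close>. The boundary condition fixes the
  coefficient of \<open>c\<^sup>d\<close>, and \<open>d = 0\<close> is the claim.
\<close>

lemma binomiacci_commute: "binomiacci k n = binomiacci n k"
proof (induction k n rule: binomiacci.induct)
  case (3 k n)
  then show ?case by simp
qed (simp_all add: binomiacci_right_0)

definition diagonal_gf :: "nat \<Rightarrow> complex fps" where
  "diagonal_gf d = Abs_fps (\<lambda>n. of_nat (binomiacci n (n + d)))"

lemma diagonal_gf_nth: "fps_nth (diagonal_gf d) n = of_nat (binomiacci n (n + d))"
  by (simp add: diagonal_gf_def)

lemma central_binomiacci_gf_eq_diagonal_gf: "central_binomiacci_gf = diagonal_gf 0"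
  by (simp add: central_binomiacci_gf_def diagonal_gf_def)

lemma diagonal_gf_0: "diagonal_gf 0 = 1 + 2 * fps_X * diagonal_gf 1"
proof (rule fps_ext)
  fix n
  show "fps_nth (diagonal_gf 0) n = fps_nth (1 + 2 * fps_X * diagonal_gf 1) n"
  proof (cases n)
    case (Suc m)
    have "binomiacci (Suc m) (Suc m) = 2 * binomiacci m (Suc m)"
      by (simp add: binomiacci_commute[of "Suc m" m])
    with Suc show ?thesis
      by (simp add: diagonal_gf_nth mult.assoc numeral_fps_const del: binomiacci.simps)
  qed (simp add: diagonal_gf_nth mult.assoc numeral_fps_const)
qed

text \<open>Positive indices are the Pascal rule; at index 0 the Fibonacci recurrence in row 0
  forces the term \<open>fib d\<close>.\<close>

lemma diagonal_gf_Suc_Suc: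
  "fps_X * diagonal_gf (Suc (Suc d)) = diagonal_gf (Suc d) - diagonal_gf d - of_nat (fib d)"
proof (rule fps_ext)
  fix n
  show "fps_nth (fps_X * diagonal_gf (Suc (Suc d))) n =
        fps_nth (diagonal_gf (Suc d) - diagonal_gf d - of_nat (fib d)) n"
    by (cases n) (simp_all add: diagonal_gf_nth flip: fps_of_nat)
qed

text \<open>Coefficient \<open>n\<close> of \<open>fps_X * E d\<close> is an earlier coefficient of
  \<open>E d\<close>, so it vanishes by induction for all \<open>d\<close> at once; the boundary
  then settles \<open>E 0\<close>, and \<open>step\<close> passes from \<open>d\<close> to
  \<open>Suc d\<close>.\<close>

lemma diagonal_recurrence_unique:
  fixes E :: "nat \<Rightarrow> 'a::comm_ring_1 fps"
  assumes boundary: "E 0 = 2 * fps_X * E 1"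
    and step: "\<And>d. fps_X * E (Suc (Suc d)) = E (Suc d) - E d"
  shows "E d = 0"
proof (rule fps_ext)
  fix n
  show "fps_nth (E d) n = fps_nth 0 n"
  proof (induction n arbitrary: d rule: less_induct)
    case (less n)
    have shifted: "fps_nth (fps_X * E d) n = 0" for d
      using less by (cases n) simp_all
    show ?case
    proof (induction d)
      case 0
      show ?case
        by (simp only: boundary mult.assoc numeral_fps_const fps_mult_left_const_nth shifted) simp
    next
      case (Suc d)
      with shifted[of "Suc (Suc d)"] show ?case
        by (simp add: step)
    qed
  qed
qed

lemma fps_eqI_power2:
  fixes f g :: "'a::idom fps"
  assumes "f\<^sup>2 = g\<^sup>2" and "fps_nth f 0 + fps_nth g 0 \<noteq> 0"
  shows "f = g"
proof -
  have "f \<noteq> - g"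
    using assms(2) by auto
  with assms(1) show ?thesis
    by (simp add: power2_eq_iff)
qed

text \<open>Near 0 the argument avoids the branch cut, so an expansion exists; its square and
  constant term identify it.\<close>

lemma csqrt_has_fps_expansion:
  "(\<lambda>s. csqrt (1 - 4 * s)) has_fps_expansion sqrt_1_minus_4X"
proof -
  have "(\<lambda>s. csqrt (1 - 4 * s)) analytic_on {0}"
    by (intro analytic_intros) auto
  then obtain F where F: "(\<lambda>s. csqrt (1 - 4 * s)) has_fps_expansion F"
    by (meson analytic_at_imp_has_fps_expansion_0)
  have "(\<lambda>s. (csqrt (1 - 4 * s))\<^sup>2) has_fps_expansion F\<^sup>2"
    by (intro fps_expansion_intros F)
  moreover have "(\<lambda>s::complex. 1 - 4 * s) has_fps_expansion 1 - 4 * fps_X"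
    by (intro fps_expansion_intros)
  ultimately have sq: "F\<^sup>2 = sqrt_1_minus_4X\<^sup>2"
    unfolding sqrt_1_minus_4X_power2 power2_csqrt by (rule fps_expansion_unique_complex)
  have "fps_nth F 0 = 1"
    using has_fps_expansion_imp_0_eq_fps_nth_0[OF F] by simp
  with sq have "F = sqrt_1_minus_4X"
    by (simp add: fps_eqI_power2 sqrt_1_minus_4X_nth_0)
  with F show ?thesis
    by simp
qed

lemma diagonal_gf_closed_form:
  fixes r c :: "complex fps"
  assumes c: "fps_X * c\<^sup>2 = c - 1" and r: "r = 1 - 2 * fps_X * c"
  shows "r * (1 - 4 * fps_X - fps_X\<^sup>2) * diagonal_gf d =
           r * (of_nat (fib (Suc d)) + fps_X * (2 * of_nat (fib d) - of_nat (fib (Suc d))))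
           - fps_X * (1 - fps_X) * c ^ d"
proof -
  define P where
    "P d = (of_nat (fib (Suc d)) + fps_X * (2 * of_nat (fib d) - of_nat (fib (Suc d))) :: complex fps)"
    for d
  \<comment> \<open>Defect of the claimed formula: the \<open>fib d\<close> terms from
    \<open>diagonal_gf\<close> and \<open>P\<close> cancel, leaving the homogeneous
    recurrence.\<close>
  define E where
    "E d = r * (1 - 4 * fps_X - fps_X\<^sup>2) * diagonal_gf d - r * P d + fps_X * (1 - fps_X) * c ^ d"
    for d
  have "E d = 0"
  proof (rule diagonal_recurrence_unique)
    have P: "P 0 = 1 - fps_X" "P 1 = 1 + fps_X"
      by (simp_all add: P_def)
    show "E 0 = 2 * fps_X * E 1"
      unfolding E_def diagonal_gf_0 P power_0 power_one_right using r by algebra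
  next
    fix d
    have P: "fps_X * P (Suc (Suc d)) =
        P (Suc d) - P d - (1 - 4 * fps_X - fps_X\<^sup>2) * of_nat (fib d)"
      by (simp add: P_def algebra_simps power2_eq_square)
    have "fps_X * c ^ Suc (Suc d) = c ^ d * (fps_X * c\<^sup>2)"
      by (simp add: power2_eq_square)
    then have C: "fps_X * c ^ Suc (Suc d) = c ^ Suc d - c ^ d"
      by (simp add: c algebra_simps)
    have "fps_X * E (Suc (Suc d)) =
        r * (1 - 4 * fps_X - fps_X\<^sup>2) * (fps_X * diagonal_gf (Suc (Suc d)))
        - r * (fps_X * P (Suc (Suc d))) + fps_X * (1 - fps_X) * (fps_X * c ^ Suc (Suc d))"
      unfolding E_def by (simp only: algebra_simps)
    also have "\<dots> = E (Suc d) - E d"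
      unfolding P C diagonal_gf_Suc_Suc E_def by (simp only: algebra_simps)
    finally show "fps_X * E (Suc (Suc d)) = E (Suc d) - E d" .
  qed
  then show ?thesis
    by (simp add: E_def P_def algebra_simps)
qed

text \<open>As 4s = (1 - r)(1 + r), the witness 2 / (1 + r) is (1 - r) / (2s) without dividing by
  s.\<close>

lemma catalan_series_exists:
  obtains c :: "complex fps"
  where "fps_X * c\<^sup>2 = c - 1" and "sqrt_1_minus_4X = 1 - 2 * fps_X * c"
proof
  let ?r = sqrt_1_minus_4X
  let ?i = "inverse (1 + ?r)"
  have i: "?i * (1 + ?r) = 1"
    by (rule inverse_mult_eq_1) (simp add: sqrt_1_minus_4X_nth_0)
  show "fps_X * (2 * ?i)\<^sup>2 = 2 * ?i - 1" "?r = 1 - 2 * fps_X * (2 * ?i)"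
    using i sqrt_1_minus_4X_power2 by algebra+
qed

theorem theorem2p2:
  shows "central_binomiacci_gf =
           ((fps_X - 1) * (sqrt_1_minus_4X - fps_X)) /
           ((fps_X\<^sup>2 + 4 * fps_X - 1) * sqrt_1_minus_4X)
       \<and> (\<lambda>s::complex. ((s - 1) * (csqrt (1 - 4 * s) - s)) /
                       ((s\<^sup>2 + 4 * s - 1) * csqrt (1 - 4 * s)))
         has_fps_expansion central_binomiacci_gf"
proof -
  let ?r = sqrt_1_minus_4X
  let ?num = "(fps_X - 1) * (?r - fps_X)"
  let ?den = "(fps_X\<^sup>2 + 4 * fps_X - 1) * ?r"
  obtain c where "fps_X * c\<^sup>2 = c - 1" "?r = 1 - 2 * fps_X * c"
    by (rule catalan_series_exists)
  from diagonal_gf_closed_form[OF this, of 0]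
  have "?r * (1 - 4 * fps_X - fps_X\<^sup>2) * central_binomiacci_gf =
          ?r * (1 - fps_X) - fps_X * (1 - fps_X)"
    by (simp add: central_binomiacci_gf_eq_diagonal_gf)
  then have "central_binomiacci_gf * ?den = ?num"
    by algebra
  \<comment> \<open>The constant term is -1; this permits both the cancellation and the expansion of
    the quotient.\<close>
  moreover have den_0: "fps_nth ?den 0 \<noteq> 0"
    by (simp add: sqrt_1_minus_4X_nth_0 numeral_fps_const)
  then have "?den \<noteq> 0"
    by (metis fps_zero_nth)
  ultimately have gf: "central_binomiacci_gf = ?num / ?den"
    by (metis nonzero_mult_div_cancel_right)
  have "(\<lambda>s::complex. ((s - 1) * (csqrt (1 - 4 * s) - s)) /
          ((s\<^sup>2 + 4 * s - 1) * csqrt (1 - 4 * s))) has_fps_expansion ?num / ?den"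
    by (intro has_fps_expansion_divide' den_0 fps_expansion_intros csqrt_has_fps_expansion)
  with gf show ?thesis
    by simp
qed

end
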